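(* Let $G$ be a connected finite-dimensional Lie group with Lie algebra $\mathfrak{g}$, $M$ a smooth connected manifold, $h\colon G\times M\to M$ a transitive right Lie group action, $y_0\in M$ a fixed point with $\operatorname{stab}(y_0)$ closed in $G$, and $h_{y_0}(X)=h(X,y_0)$. Consider the projected system on $M$ $$\dot y = T_Xh_{y_0}(Xu),\qquad X\in h_{y_0}^{-1}(y).$$ Then any observer with an internal model of this system has the form $$\dot{\hat y} = T_{\hat X}h_{y_0}(\hat Xu)+\alpha(\hat y,u,y,t),\qquad \hat X\in h_{y_0}^{-1}(\hat y),$$ where $\alpha$ is an innovation term.
   Context: Right action means $h(X,h(Y,y))=h(YX,y)$. $\operatorname{stab}(y_0)=\{X\in G\mid h(X,y_0)=y_0\}$. For $X\in G$, $u\in\mathfrak{g}$, $Xu:=T_eL_Xu$ with $L_X$ left multiplication. The expression $T_Xh_{y_0}(Xu)$ depends only on $y=h_{y_0}(X)$ and $u$, so it defines a system on $M$. An input $u\colon\mathbb{R}\to\mathfrak{g}$ is admissible if $\dot X=Xu(t)$ has unique solutions for all initial values. An observer is a system $\dot{\hat y}=f(\hat y,u,y,t)$ on $M$, with $f(\hat y,u,y,t)\in T_{\hat y}M$, driven by the input $u$ and by the solution $y$ of the projected system for the same input. Write $y(t,z,u)$ for the solution of the projected system with initial value $z\in M$ and input $u$, and $\hat y(t,z,y(t,z,u),u)$ for the observer solution with initial value $z$, driven by $y(\cdot,z,u)$ and $u$. The observer has an internal model of the projected system if for all admissible inputs $u$, all $z\in M$ and all $t\in\mathbb{R}^+$ $$\hat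 y(t,z,y(t,z,u),u)=y(t,z,u).$$ An innovation term is a map $\alpha\colon M\times\mathfrak{g}\times M\times\mathbb{R}\to TM$ such that (a) $\alpha(\hat y,u,y,t)\in T_{\hat y}M$; (b) $\alpha\big(\hat y(t,z,y(t,z,u),u),u(t),y(t,z,u),t\big)=0$ for all $z\in M$, all $t\in\mathbb{R}$ and all admissible inputs $u$.
   Formalization: The innovation term is shown to vanish along matched solutions for t ≥ 0, and for all real t if the internal model identity holds for all real t; with the identity only on t ≥ 0, vanishing for all real t is false (G = M = ℝ, observer u + b(t) with b = 0 only for t ≥ 0). *)

theory Defs
  imports "HOL-Analysis.Analysis" "HOL-Algebra.Group"
begin

section \<open>Smooth manifolds\<close>

text \<open>\<open>Ck_on n S f\<close> is meant for open sets \<open>S\<close> only: the derivative is the unrestricted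
  Frechet derivative at the points of \<open>S\<close>.\<close>

primrec Ck_on :: "nat \<Rightarrow> 'a::real_normed_vector set \<Rightarrow> ('a \<Rightarrow> 'b::real_normed_vector) \<Rightarrow> bool" where
  "Ck_on 0 S f \<longleftrightarrow> continuous_on S f"
| "Ck_on (Suc n) S f \<longleftrightarrow>
     (\<forall>x\<in>S. f differentiable (at x)) \<and> (\<forall>v. Ck_on n S (\<lambda>x. frechet_derivative f (at x) v))"

definition smooth_on :: "'a::real_normed_vector set \<Rightarrow> ('a \<Rightarrow> 'b::real_normed_vector) \<Rightarrow> bool" where
  "smooth_on S f \<longleftrightarrow> (\<forall>n. Ck_on n S f)"

text \<open>A chart \<open>(U, \<phi>)\<close> is a total function \<open>\<phi>\<close> of which only the values on \<open>U\<close> matter. The model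
  space \<open>'e\<close> is any finite-dimensional inner product space. Dimension 0 is allowed, so the class
  \<open>euclidean_space\<close>, which forces positive dimension, is not used.\<close>

type_synonym ('m, 'e) chart = "'m set \<times> ('m \<Rightarrow> 'e)"

definition is_chart :: "('m::topological_space, 'e::real_inner) chart \<Rightarrow> bool" where
  "is_chart c \<longleftrightarrow> (case c of (U, \<phi>) \<Rightarrow>
     open U \<and> open (\<phi> ` U) \<and> homeomorphism U (\<phi> ` U) \<phi> (inv_into U \<phi>))"

definition smooth_compatible ::
    "('m::topological_space, 'e::real_inner) chart \<Rightarrow> ('m, 'e) chart \<Rightarrow> bool" where
  "smooth_compatible c d \<longleftrightarrow> (case c of (U, \<phi>) \<Rightarrow> case d of (V, \<psi>) \<Rightarrow>
     smooth_on (\<phi> ` (U \<inter> V)) (\<psi> \<circ> inv_into U \<phi>))"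

text \<open>The manifold is the whole type. The atlas need not be maximal; the smooth structure is the
  one it generates.\<close>

definition smooth_manifold ::
    "('m::{t2_space,second_countable_topology}, 'e::real_inner) chart set \<Rightarrow> bool" where
  "smooth_manifold A \<longleftrightarrow>
     (\<exists>B::'e set. finite B \<and> span B = UNIV) \<and>
     (\<forall>c\<in>A. is_chart c) \<and>
     (\<Union>c\<in>A. fst c) = UNIV \<and>
     (\<forall>c\<in>A. \<forall>d\<in>A. smooth_compatible c d)"

definition smooth_map ::
    "('m::topological_space, 'e::real_inner) chart set \<Rightarrow>
     ('n::topological_space, 'f::real_inner) chart set \<Rightarrow> ('m \<Rightarrow> 'n) \<Rightarrow> bool" where
  "smooth_map A B F \<longleftrightarrow> continuous_on UNIV F \<and>
     (\<forall>(U, \<phi>)\<in>A. \<forall>(V, \<psi>)\<in>B. smooth_on (\<phi> ` (U \<inter> F -` V)) (\<psi> \<circ> F \<circ> inv_into U \<phi>))"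

definition prod_atlas ::
    "('m, 'e) chart set \<Rightarrow> ('n, 'f) chart set \<Rightarrow> ('m \<times> 'n, 'e \<times> 'f) chart set" where
  "prod_atlas A B = {(U \<times> V, map_prod \<phi> \<psi>) | U \<phi> V \<psi>. (U, \<phi>) \<in> A \<and> (V, \<psi>) \<in> B}"

definition smooth_fun :: "('m::topological_space, 'e::real_inner) chart set \<Rightarrow> ('m \<Rightarrow> real) \<Rightarrow> bool" where
  "smooth_fun A g \<longleftrightarrow> smooth_map A {(UNIV, \<lambda>x::real. x)} g"

section \<open>Tangent vectors\<close>

text \<open>Tangent vectors at \<open>p\<close> are the derivations at \<open>p\<close> of the algebra of smooth functions. A
  derivation is a functional on all functions and is normalised to 0 on the non-smooth ones, so
  that equality of tangent vectors is equality in HOL. The base point is not part of the vector.\<close>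

type_synonym 'm tvec = "('m \<Rightarrow> real) \<Rightarrow> real"

definition tangent_space ::
    "('m::topological_space, 'e::real_inner) chart set \<Rightarrow> 'm \<Rightarrow> 'm tvec set" where
  "tangent_space A p = {v.
     (\<forall>f g. smooth_fun A f \<longrightarrow> smooth_fun A g \<longrightarrow> v (\<lambda>x. f x + g x) = v f + v g) \<and>
     (\<forall>c f. smooth_fun A f \<longrightarrow> v (\<lambda>x. c * f x) = c * v f) \<and>
     (\<forall>f g. smooth_fun A f \<longrightarrow> smooth_fun A g \<longrightarrow> v (\<lambda>x. f x * g x) = v f * g p + f p * v g) \<and>
     (\<forall>f. \<not> smooth_fun A f \<longrightarrow> v f = 0)}"

text \<open>The differential of \<open>F\<close>. For derivations the formula is the same at every base point.\<close>

definition tangent_map ::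
    "('n::topological_space, 'f::real_inner) chart set \<Rightarrow> ('m \<Rightarrow> 'n) \<Rightarrow> 'm tvec \<Rightarrow> 'n tvec" where
  "tangent_map B F v = (\<lambda>g. if smooth_fun B g then v (g \<circ> F) else 0)"

text \<open>\<open>has_velocity A c v T t\<close>: the curve \<open>c\<close>, restricted to the time set \<open>T\<close>, is differentiable
  at \<open>t\<close> with derivative \<open>v\<close>. Testing against all smooth functions includes
  suitably cut-off coordinate functions, so this is differentiability in charts.\<close>

definition has_velocity ::
    "('m::topological_space, 'e::real_inner) chart set \<Rightarrow> (real \<Rightarrow> 'm) \<Rightarrow> 'm tvec \<Rightarrow> real set \<Rightarrow> real \<Rightarrow> bool" where
  "has_velocity A c v T t \<longleftrightarrow> v \<in> tangent_space A (c t) \<and>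
     (\<forall>g. smooth_fun A g \<longrightarrow> ((\<lambda>s. g (c s)) has_real_derivative v g) (at t within T))"

section \<open>Lie groups and right actions\<close>

definition lie_group ::
    "('g::{t2_space,second_countable_topology}) monoid \<Rightarrow> ('g, 'e::real_inner) chart set \<Rightarrow> bool" where
  "lie_group G A \<longleftrightarrow> group G \<and> carrier G = UNIV \<and> smooth_manifold A \<and>
     smooth_map (prod_atlas A A) A (\<lambda>(X, Y). X \<otimes>\<^bsub>G\<^esub> Y) \<and>
     smooth_map A A (\<lambda>X. inv\<^bsub>G\<^esub> X)"

definition lie_algebra :: "('g::topological_space) monoid \<Rightarrow> ('g, 'e::real_inner) chart set \<Rightarrow> 'g tvec set" where
  "lie_algebra G A = tangent_space A \<one>\<^bsub>G\<^esub>"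

definition left_translate ::
    "('g::topological_space) monoid \<Rightarrow> ('g, 'e::real_inner) chart set \<Rightarrow> 'g \<Rightarrow> 'g tvec \<Rightarrow> 'g tvec" where
  "left_translate G A X u = tangent_map A (\<lambda>Z. X \<otimes>\<^bsub>G\<^esub> Z) u"

definition right_lie_action ::
    "('g::{t2_space,second_countable_topology}) monoid \<Rightarrow> ('g, 'e::real_inner) chart set \<Rightarrow>
     ('m::{t2_space,second_countable_topology}, 'f::real_inner) chart set \<Rightarrow> ('g \<Rightarrow> 'm \<Rightarrow> 'm) \<Rightarrow> bool" where
  "right_lie_action G A B h \<longleftrightarrow>
     smooth_map (prod_atlas A B) B (\<lambda>(X, y). h X y) \<and>
     (\<forall>y. h \<one>\<^bsub>G\<^esub> y = y) \<and>
     (\<forall>X Y y. h X (h Y y) = h (Y \<otimes>\<^bsub>G\<^esub> X) y)"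

definition transitive_action :: "('g \<Rightarrow> 'm \<Rightarrow> 'm) \<Rightarrow> bool" where
  "transitive_action h \<longleftrightarrow> (\<forall>y z. \<exists>X. h X y = z)"

definition stabilizer :: "('g \<Rightarrow> 'm \<Rightarrow> 'm) \<Rightarrow> 'm \<Rightarrow> 'g set" where
  "stabilizer h y0 = {X. h X y0 = y0}"

section \<open>The projected system\<close>

definition projected_velocity ::
    "'g monoid \<Rightarrow> ('g::topological_space, 'e::real_inner) chart set \<Rightarrow>
     ('m::topological_space, 'f::real_inner) chart set \<Rightarrow>
     ('g \<Rightarrow> 'm \<Rightarrow> 'm) \<Rightarrow> 'm \<Rightarrow> 'g \<Rightarrow> 'g tvec \<Rightarrow> 'm tvec" where
  "projected_velocity G A B h y0 X u = tangent_map B (\<lambda>Z. h Z y0) (left_translate G A X u)"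

definition admissible_input ::
    "'g monoid \<Rightarrow> ('g::topological_space, 'e::real_inner) chart set \<Rightarrow> (real \<Rightarrow> 'g tvec) \<Rightarrow> bool" where
  "admissible_input G A u \<longleftrightarrow> (\<forall>t. u t \<in> lie_algebra G A) \<and>
     (\<forall>X0. \<exists>!X. X 0 = X0 \<and> (\<forall>t. has_velocity A X (left_translate G A (X t) (u t)) UNIV t))"

text \<open>\<open>y = y(\<sqdot>, z, u)\<close>. All \<open>X\<close> over \<open>y t\<close> give the same velocity, and by transitivity there is
  at least one.\<close>

definition projected_solution ::
    "'g monoid \<Rightarrow> ('g::topological_space, 'e::real_inner) chart set \<Rightarrow>
     ('m::topological_space, 'f::real_inner) chart set \<Rightarrow>
     ('g \<Rightarrow> 'm \<Rightarrow> 'm) \<Rightarrow> 'm \<Rightarrow> (real \<Rightarrow> 'g tvec) \<Rightarrow> 'm \<Rightarrow> (real \<Rightarrow> 'm) \<Rightarrow> bool" where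
  "projected_solution G A B h y0 u z y \<longleftrightarrow> y 0 = z \<and>
     (\<forall>t X. h X y0 = y t \<longrightarrow> has_velocity B y (projected_velocity G A B h y0 X (u t)) UNIV t)"

section \<open>Observers\<close>

text \<open>The right-hand side \<open>f yhat u y t\<close> of an observer. Its values for \<open>u\<close> outside the Lie algebra
  are irrelevant.\<close>

type_synonym ('g, 'm) rhs = "'m \<Rightarrow> 'g tvec \<Rightarrow> 'm \<Rightarrow> real \<Rightarrow> 'm tvec"

definition tangent_valued ::
    "'g monoid \<Rightarrow> ('g::topological_space, 'e::real_inner) chart set \<Rightarrow>
     ('m::topological_space, 'f::real_inner) chart set \<Rightarrow> ('g, 'm) rhs \<Rightarrow> bool" where
  "tangent_valued G A B f \<longleftrightarrow>
     (\<forall>yhat y t. \<forall>u\<in>lie_algebra G A. f yhat u y t \<in> tangent_space B yhat)"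

definition observer_solution ::
    "('m::topological_space, 'f::real_inner) chart set \<Rightarrow> real set \<Rightarrow> ('g, 'm) rhs \<Rightarrow>
     (real \<Rightarrow> 'g tvec) \<Rightarrow> (real \<Rightarrow> 'm) \<Rightarrow> 'm \<Rightarrow> (real \<Rightarrow> 'm) \<Rightarrow> bool" where
  "observer_solution B T f u y z yhat \<longleftrightarrow> yhat 0 = z \<and>
     (\<forall>t\<in>T. has_velocity B yhat (f (yhat t) (u t) (y t) t) T t)"

text \<open>\<open>T\<close> is the time axis, \<open>{0..}\<close> or \<open>UNIV\<close>. The solution of the observer with initial value
  \<open>z\<close> is required to exist on \<open>T\<close>; the second clause includes its uniqueness on \<open>T\<close>.\<close>

definition has_internal_model ::
    "'g monoid \<Rightarrow> ('g::topological_space, 'e::real_inner) chart set \<Rightarrow>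
     ('m::topological_space, 'f::real_inner) chart set \<Rightarrow>
     ('g \<Rightarrow> 'm \<Rightarrow> 'm) \<Rightarrow> 'm \<Rightarrow> real set \<Rightarrow> ('g, 'm) rhs \<Rightarrow> bool" where
  "has_internal_model G A B h y0 T f \<longleftrightarrow>
     (\<forall>u z y. admissible_input G A u \<longrightarrow> projected_solution G A B h y0 u z y \<longrightarrow>
        (\<exists>yhat. observer_solution B T f u y z yhat) \<and>
        (\<forall>yhat. observer_solution B T f u y z yhat \<longrightarrow> (\<forall>t\<in>T. yhat t = y t)))"

text \<open>The observer \<open>f\<close> is a parameter because its solutions occur in the vanishing condition.\<close>

definition innovation_term ::
    "'g monoid \<Rightarrow> ('g::topological_space, 'e::real_inner) chart set \<Rightarrow>
     ('m::topological_space, 'f::real_inner) chart set \<Rightarrow>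
     ('g \<Rightarrow> 'm \<Rightarrow> 'm) \<Rightarrow> 'm \<Rightarrow> real set \<Rightarrow> ('g, 'm) rhs \<Rightarrow> ('g, 'm) rhs \<Rightarrow> bool" where
  "innovation_term G A B h y0 T f \<alpha> \<longleftrightarrow>
     tangent_valued G A B \<alpha> \<and>
     (\<forall>u z y yhat. admissible_input G A u \<longrightarrow> projected_solution G A B h y0 u z y \<longrightarrow>
        observer_solution B T f u y z yhat \<longrightarrow>
        (\<forall>t\<in>T. \<alpha> (yhat t) (u t) (y t) t = (\<lambda>g. 0)))"

end

theory Submission
  imports Defs
begin

text \<open>
  The observer decides what the innovation term has to be: \<open>\<alpha>\<close> is the difference between the
  right-hand side \<open>f\<close> and the projected vector field. The content is that this difference is
  well defined, tangent to the manifold, and zero along the matched trajectories.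

  \<^item> It is well defined because of the right action law: \<open>h(XZ, y0) = h(Z, h(X, y0))\<close>, so pushing
    \<open>Xu\<close> down to the manifold only sees \<open>u\<close> and the point \<open>h(X, y0)\<close> (lemma
    \<open>projected_velocity_cong\<close>); by transitivity every point of the manifold is of that form.
  \<^item> It is tangent to the manifold because differentials of smooth maps send derivations to
    derivations (lemma \<open>tangent_map_in_tangent_space\<close>). This needs that smooth functions form an
    algebra, that they pull back along smooth maps, and that the partial maps of a smooth map on a
    product are smooth, so that the left translations and the orbit map are smooth.
  \<^item> It vanishes along matched trajectories because the internal model makes the observer solution
    and the projected solution the same curve on the time axis, and a curve has only one velocity
    at a time that is not isolated in the time axis (lemma \<open>has_velocity_unique\<close>). Nothing else
    about the time axis matters, so the same \<open>\<alpha>\<close> serves the half line and the whole line.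

  The analytic work is the calculus of \<open>Ck_on\<close>, in which the class of a map is tested by its
  directional derivatives only. The chain rule for that notion writes the inner derivative
  in coordinates, which is the place where the finite dimension of the model spaces enters.
\<close>

section \<open>Calculus of continuously differentiable maps\<close>

lemma Ck_on_SucD:
  assumes "Ck_on (Suc n) S f"
  shows "x \<in> S \<Longrightarrow> (f has_derivative frechet_derivative f (at x)) (at x)"
    and "Ck_on n S (\<lambda>x. frechet_derivative f (at x) v)"
  using assms by (auto simp: frechet_derivative_works)

lemma Ck_on_cong:
  assumes "open S" "\<And>x. x \<in> S \<Longrightarrow> f x = g x" "Ck_on n S f"
  shows "Ck_on n S g"
  using assms(2,3)
proof (induction n arbitrary: f g)
  case 0
  then show ?case by (simp cong: continuous_on_cong)
next
  case (Suc n)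
  have g: "(g has_derivative frechet_derivative f (at x)) (at x)" if "x \<in> S" for x
    using has_derivative_transform_within_open[OF Ck_on_SucD(1)[OF Suc.prems(2) that] assms(1) that]
      Suc.prems(1) by blast
  have "Ck_on n S (\<lambda>x. frechet_derivative g (at x) v)" for v
    using Suc.IH[OF _ Ck_on_SucD(2)[OF Suc.prems(2), of v]] frechet_derivative_at[OF g] by metis
  then show ?case
    using g by (auto simp: differentiable_def)
qed

text \<open>Derivatives are unique and the class is local on open sets, so any explicit formula \<open>D\<close> for the
  derivative on \<open>S\<close> can stand in for \<open>frechet_derivative\<close>. The calculus rules all go
  through this rule.\<close>

lemma Ck_on_SucI:
  assumes "open S" "\<And>x. x \<in> S \<Longrightarrow> (f has_derivative D x) (at x)" "\<And>v. Ck_on n S (\<lambda>x. D x v)"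
  shows "Ck_on (Suc n) S f"
proof -
  have "Ck_on n S (\<lambda>x. frechet_derivative f (at x) v)" for v
    by (rule Ck_on_cong[OF assms(1) _ assms(3)[of v]])
      (simp add: frechet_derivative_at[OF assms(2), symmetric])
  then show ?thesis
    using assms(2) by (auto simp: differentiable_def)
qed

lemma Ck_on_Suc_imp:
  assumes "Ck_on (Suc n) S f"
  shows "Ck_on n S f"
  using assms
proof (induction n arbitrary: f)
  case 0
  then show ?case
    by (auto intro!: differentiable_imp_continuous_on simp: differentiable_on_def
        differentiable_at_withinI)
next
  case (Suc n)
  from Suc.prems have "\<forall>x\<in>S. f differentiable (at x)"
    and "\<forall>v. Ck_on (Suc n) S (\<lambda>x. frechet_derivative f (at x) v)"
    unfolding Ck_on.simps(2)[of "Suc n"] by auto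
  moreover from this(2) have "\<forall>v. Ck_on n S (\<lambda>x. frechet_derivative f (at x) v)"
    using Suc.IH by blast
  ultimately show ?case by simp
qed

lemma Ck_on_subset:
  assumes "S \<subseteq> T" "Ck_on n T f"
  shows "Ck_on n S f"
  using assms(2)
proof (induction n arbitrary: f)
  case 0
  then show ?case using continuous_on_subset[OF _ assms(1)] by simp
next
  case (Suc n)
  then show ?case using assms(1) by auto
qed

lemma Ck_on_UN:
  assumes "\<And>i. i \<in> I \<Longrightarrow> open (S i)" "\<And>i. i \<in> I \<Longrightarrow> Ck_on n (S i) f"
  shows "Ck_on n (\<Union>i\<in>I. S i) f"
  using assms(2)
proof (induction n arbitrary: f)
  case 0
  then show ?case using assms(1) by (auto intro: continuous_on_open_UN)
next
  case (Suc n)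
  have "Ck_on n (\<Union>i\<in>I. S i) (\<lambda>x. frechet_derivative f (at x) v)" for v
    by (rule Suc.IH) (rule Ck_on_SucD(2)[OF Suc.prems])
  then show ?case using Suc.prems by auto
qed

lemma Ck_on_const: "open S \<Longrightarrow> Ck_on n S (\<lambda>x. c)"
proof (induction n arbitrary: c)
  case (Suc n)
  show ?case by (rule Ck_on_SucI[OF Suc.prems has_derivative_const Suc.IH[OF Suc.prems]])
qed simp

lemma Ck_on_add:
  assumes "open S" "Ck_on n S f" "Ck_on n S g"
  shows "Ck_on n S (\<lambda>x. f x + g x)"
  using assms(2,3)
proof (induction n arbitrary: f g)
  case 0
  then show ?case by (simp add: continuous_on_add)
next
  case (Suc n)
  show ?case
    by (rule Ck_on_SucI[OF assms(1) has_derivative_add[OF Ck_on_SucD(1)[OF Suc.prems(1)]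
            Ck_on_SucD(1)[OF Suc.prems(2)]]])
      (use Suc.IH Ck_on_SucD(2)[OF Suc.prems(1)] Ck_on_SucD(2)[OF Suc.prems(2)] in simp_all)
qed

lemma Ck_on_sum:
  assumes "open S" "\<And>c. c \<in> C \<Longrightarrow> Ck_on n S (f c)"
  shows "Ck_on n S (\<lambda>x. \<Sum>c\<in>C. f c x)"
  using assms(2)
  by (induction C rule: infinite_finite_induct)
    (auto intro: Ck_on_const Ck_on_add assms(1))

lemma Ck_on_bounded_linear:
  assumes "bounded_linear L" "open S" "Ck_on n S f"
  shows "Ck_on n S (\<lambda>x. L (f x))"
  using assms(3)
proof (induction n arbitrary: f)
  case 0
  then show ?case by (auto intro: bounded_linear.continuous_on[OF assms(1)])
next
  case (Suc n)
  show ?case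
    by (rule Ck_on_SucI[OF assms(2) bounded_linear.has_derivative[OF assms(1)
            Ck_on_SucD(1)[OF Suc.prems]] Suc.IH[OF Ck_on_SucD(2)[OF Suc.prems]]])
qed

lemma Ck_on_bounded_bilinear:
  assumes "bounded_bilinear b" "open S" "Ck_on n S f" "Ck_on n S g"
  shows "Ck_on n S (\<lambda>x. b (f x) (g x))"
  using assms(3,4)
proof (induction n arbitrary: f g)
  case 0
  then show ?case by (auto intro: bounded_bilinear.continuous_on[OF assms(1)])
next
  case (Suc n)
  show ?case
  proof (rule Ck_on_SucI[OF assms(2) bounded_bilinear.FDERIV[OF assms(1)]])
    show "(f has_derivative frechet_derivative f (at x)) (at x)"
      "(g has_derivative frechet_derivative g (at x)) (at x)" if "x \<in> S" for x
      using Ck_on_SucD(1)[OF Suc.prems(1) that] Ck_on_SucD(1)[OF Suc.prems(2) that] .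
    show "Ck_on n S (\<lambda>x. b (f x) (frechet_derivative g (at x) v) +
                          b (frechet_derivative f (at x) v) (g x))" for v
      by (intro Ck_on_add assms(2) Suc.IH Ck_on_SucD(2)[OF Suc.prems(1)]
          Ck_on_SucD(2)[OF Suc.prems(2)] Ck_on_Suc_imp[OF Suc.prems(1)]
          Ck_on_Suc_imp[OF Suc.prems(2)])
  qed
qed

text \<open>The derivative of the composite in direction \<open>v\<close> is the derivative of \<open>g\<close> in the constant
  direction \<open>L v\<close>, again precomposed with the affine map, so the induction closes directly.
  This is used to restrict a map to a slice of a product.\<close>

lemma Ck_on_compose_affine:
  assumes "bounded_linear L" "open S" "\<And>x. x \<in> S \<Longrightarrow> L x + c \<in> T" "Ck_on n T g"
  shows "Ck_on n S (\<lambda>x. g (L x + c))"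
  using assms(4)
proof (induction n arbitrary: g)
  case 0
  have "continuous_on S (\<lambda>x. L x + c)"
    by (intro continuous_intros bounded_linear.continuous_on[OF assms(1)])
  then show ?case
    using 0 assms(3) by (auto intro: continuous_on_compose2)
next
  case (Suc n)
  have aff: "((\<lambda>x. L x + c) has_derivative L) (at x)" for x
    by (intro has_derivative_add_const bounded_linear_imp_has_derivative assms(1))
  show ?case
  proof (rule Ck_on_SucI[OF assms(2)])
    show "((\<lambda>x. g (L x + c)) has_derivative (\<lambda>v. frechet_derivative g (at (L x + c)) (L v))) (at x)"
      if "x \<in> S" for x
      using has_derivative_compose[OF aff Ck_on_SucD(1)[OF Suc.prems assms(3)[OF that]]] .
    show "Ck_on n S (\<lambda>x. frechet_derivative g (at (L x + c)) (L v))" for v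
      by (rule Suc.IH[OF Ck_on_SucD(2)[OF Suc.prems]])
  qed
qed

text \<open>An orthogonal spanning set may contain 0; there the coefficient is \<open>0 / 0 = 0\<close>.\<close>

lemma finite_span_coordinates:
  fixes E :: "'a::real_inner set"
  assumes "finite E" "span E = UNIV"
  obtains C :: "'a set" and k :: "'a \<Rightarrow> 'a \<Rightarrow> real"
  where "finite C" "\<And>c. bounded_linear (k c)" "\<And>x. x = (\<Sum>c\<in>C. k c x *\<^sub>R c)"
proof -
  obtain C :: "'a set" where C: "finite C" "span C = UNIV" "pairwise orthogonal C"
    using basis_orthogonal[OF assms(1)] assms(2) by auto
  define k where "k c x = x \<bullet> c / (c \<bullet> c)" for c x :: 'a
  have "x = (\<Sum>c\<in>C. k c x *\<^sub>R c)" for x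
  proof -
    let ?r = "x - (\<Sum>c\<in>C. k c x *\<^sub>R c)"
    have orth: "orthogonal ?r d" if d: "d \<in> C" for d
    proof -
      have "(\<Sum>c\<in>C. k c x *\<^sub>R c) \<bullet> d = (\<Sum>c\<in>C. if c = d then k d x * (d \<bullet> d) else 0)"
        unfolding inner_sum_left
        using C(3) d by (intro sum.cong) (auto simp: pairwise_def orthogonal_def)
      also have "\<dots> = x \<bullet> d"
        using C(1) d by (auto simp: k_def)
      finally show ?thesis by (simp add: inner_diff_left orthogonal_def)
    qed
    have "orthogonal ?r ?r"
      by (rule orthogonal_to_span[OF _ orth]) (simp_all only: C(2) UNIV_I)
    then show ?thesis
      unfolding orthogonal_self by (simp only: right_minus_eq)
  qed
  moreover have "bounded_linear (k c)" for c
    using bounded_linear_compose[OF bounded_linear_divide bounded_linear_inner_left]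
    unfolding k_def .
  ultimately show ?thesis using that C(1) by blast
qed

text \<open>The derivative of \<open>g \<circ> f\<close> in direction \<open>v\<close> is the derivative of \<open>g\<close> in a direction that
  depends on the point. Expanding that direction in coordinates of the middle space turns
  it into a finite sum of products of maps to which the induction hypothesis applies.\<close>

lemma Ck_on_compose:
  fixes f :: "'a::real_normed_vector \<Rightarrow> 'b::real_inner"
    and g :: "'b \<Rightarrow> 'c::real_normed_vector"
  assumes "\<exists>E::'b set. finite E \<and> span E = UNIV" "open S" "\<And>x. x \<in> S \<Longrightarrow> f x \<in> T"
    and "Ck_on n S f" "Ck_on n T g"
  shows "Ck_on n S (\<lambda>x. g (f x))"
  using assms(4,5)
proof (induction n arbitrary: g)
  case 0
  then show ?case using assms(3) by (auto intro: continuous_on_compose2)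
next
  case (Suc n)
  obtain C :: "'b set" and k :: "'b \<Rightarrow> 'b \<Rightarrow> real" where C: "finite C" "\<And>c. bounded_linear (k c)"
    and expand: "\<And>x. x = (\<Sum>c\<in>C. k c x *\<^sub>R c)"
    using assms(1) finite_span_coordinates by metis
  show ?case
  proof (rule Ck_on_SucI[OF assms(2)])
    fix x assume x: "x \<in> S"
    let ?f' = "frechet_derivative f (at x)" and ?g' = "frechet_derivative g (at (f x))"
    have g': "(g has_derivative ?g') (at (f x))"
      using Ck_on_SucD(1)[OF Suc.prems(2) assms(3)[OF x]] .
    then have lin: "linear ?g'"
      by (rule has_derivative_linear)
    have eq: "?g' w = (\<Sum>c\<in>C. k c w *\<^sub>R ?g' c)" for w
    proof -
      have "?g' w = ?g' (\<Sum>c\<in>C. k c w *\<^sub>R c)"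
        by (rule arg_cong[OF expand])
      also have "\<dots> = (\<Sum>c\<in>C. ?g' (k c w *\<^sub>R c))"
        by (rule linear_sum[OF lin])
      also have "\<dots> = (\<Sum>c\<in>C. k c w *\<^sub>R ?g' c)"
        by (simp only: linear_scale[OF lin])
      finally show ?thesis .
    qed
    show "((\<lambda>x. g (f x)) has_derivative (\<lambda>v. \<Sum>c\<in>C. k c (?f' v) *\<^sub>R ?g' c)) (at x)"
      by (rule has_derivative_eq_rhs[OF
            has_derivative_compose[OF Ck_on_SucD(1)[OF Suc.prems(1) x] g']]) (rule ext, rule eq)
  next
    show "Ck_on n S (\<lambda>x. \<Sum>c\<in>C. k c (frechet_derivative f (at x) v) *\<^sub>R
                          frechet_derivative g (at (f x)) c)" for v
      by (intro Ck_on_sum assms(2) Ck_on_bounded_bilinear[OF bounded_bilinear_scaleR]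
          Ck_on_bounded_linear[OF C(2)] Ck_on_SucD(2)[OF Suc.prems(1)]
          Suc.IH Ck_on_SucD(2)[OF Suc.prems(2)] Ck_on_Suc_imp[OF Suc.prems(1)])
  qed
qed

section \<open>Smooth maps between manifolds\<close>

lemma chart_inj_on:
  assumes "is_chart (U, \<phi>)"
  shows "inj_on \<phi> U"
  using assms unfolding is_chart_def homeomorphism_def by (auto intro: inj_on_inverseI)

lemma open_chart_image:
  assumes "is_chart (U, \<phi>)" "open W"
  shows "open (\<phi> ` (U \<inter> W))"
proof -
  have U: "open (\<phi> ` U)" and hom: "homeomorphism U (\<phi> ` U) \<phi> (inv_into U \<phi>)"
    using assms(1) by (auto simp: is_chart_def)
  have "openin (top_of_set (\<phi> ` U)) (\<phi> ` (U \<inter> W))"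
    using homeomorphism_imp_open_map[OF hom] assms(2) by (simp add: openin_open_Int)
  then show ?thesis
    using U openin_open_trans by blast
qed

lemma smooth_manifold_chart: "smooth_manifold A \<Longrightarrow> (U, \<phi>) \<in> A \<Longrightarrow> is_chart (U, \<phi>)"
  by (auto simp: smooth_manifold_def)

lemma smooth_map_Ck_on:
  assumes "smooth_map A B F" "(U, \<phi>) \<in> A" "(V, \<psi>) \<in> B"
  shows "Ck_on n (\<phi> ` (U \<inter> F -` V)) (\<psi> \<circ> F \<circ> inv_into U \<phi>)"
proof -
  from bspec[OF conjunct2[OF assms(1)[unfolded smooth_map_def]] assms(2)]
  have "\<forall>(V, \<psi>)\<in>B. smooth_on (\<phi> ` (U \<inter> F -` V)) (\<psi> \<circ> F \<circ> inv_into U \<phi>)"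
    by simp
  from bspec[OF this assms(3)] show ?thesis
    by (simp add: smooth_on_def)
qed

lemma smooth_mapI:
  assumes "continuous_on UNIV F"
    and "\<And>U \<phi> V \<psi> n. (U, \<phi>) \<in> A \<Longrightarrow> (V, \<psi>) \<in> B \<Longrightarrow>
           Ck_on n (\<phi> ` (U \<inter> F -` V)) (\<psi> \<circ> F \<circ> inv_into U \<phi>)"
  shows "smooth_map A B F"
  unfolding smooth_map_def smooth_on_def
  by (intro conjI ballI allI case_prodI2) (use assms in auto)

text \<open>Smoothness of the composite is local, and locally one can pass through a chart of the middle
  manifold.\<close>

lemma smooth_map_compose:
  fixes B :: "('n::{t2_space,second_countable_topology}, 'f::real_inner) chart set"
  assumes A: "smooth_manifold A" and B: "smooth_manifold B" and D: "\<forall>(W, \<rho>)\<in>D. open W"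
    and F: "smooth_map A B F" and g: "smooth_map B D g"
  shows "smooth_map A D (g \<circ> F)"
proof -
  have contF: "continuous_on UNIV F" and contg: "continuous_on UNIV g"
    using F g by (auto simp: smooth_map_def)
  have "Ck_on n (\<phi> ` (U \<inter> (g \<circ> F) -` W)) (\<rho> \<circ> (g \<circ> F) \<circ> inv_into U \<phi>)"
    if U: "(U, \<phi>) \<in> A" and W: "(W, \<rho>) \<in> D" for U \<phi> W \<rho> n
  proof -
    have inj: "inj_on \<phi> U" and chU: "is_chart (U, \<phi>)"
      using chart_inj_on smooth_manifold_chart[OF A U] by auto
    have gW: "open (g -` W)"
      using D W contg by (auto intro: open_vimage)
    define S where "S c = \<phi> ` (U \<inter> F -` (fst c \<inter> g -` W))" for c :: "('n, 'f) chart"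
    have cover: "\<phi> ` (U \<inter> (g \<circ> F) -` W) = (\<Union>c\<in>B. S c)"
      using B by (fastforce simp: S_def smooth_manifold_def)
    have opS: "open (S c)" if "c \<in> B" for c
    proof -
      have fst_c: "open (fst c)"
        using B that by (auto simp: smooth_manifold_def is_chart_def)
      show ?thesis
        unfolding S_def
        by (rule open_chart_image[OF chU open_vimage[OF open_Int[OF fst_c gW] contF]])
    qed
    have "Ck_on n (S c) (\<rho> \<circ> (g \<circ> F) \<circ> inv_into U \<phi>)" if c: "c \<in> B" for c
    proof -
      obtain V \<psi> where V: "c = (V, \<psi>)" by (cases c)
      have injV: "inj_on \<psi> V"
        using chart_inj_on smooth_manifold_chart[OF B] c V by auto
      have "Ck_on n (\<phi> ` (U \<inter> F -` V)) (\<psi> \<circ> F \<circ> inv_into U \<phi>)"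
        using smooth_map_Ck_on[OF F U] c V by simp
      then have f: "Ck_on n (S c) (\<psi> \<circ> F \<circ> inv_into U \<phi>)"
        by (rule Ck_on_subset[rotated]) (auto simp: S_def V)
      have g: "Ck_on n (\<psi> ` (V \<inter> g -` W)) (\<rho> \<circ> g \<circ> inv_into V \<psi>)"
        using smooth_map_Ck_on[OF g _ W] c V by simp
      have "Ck_on n (S c) (\<lambda>x. (\<rho> \<circ> g \<circ> inv_into V \<psi>) ((\<psi> \<circ> F \<circ> inv_into U \<phi>) x))"
      proof (rule Ck_on_compose[OF _ opS[OF c] _ f g])
        show "\<exists>E::'f set. finite E \<and> span E = UNIV"
          using B by (simp add: smooth_manifold_def)
        show "(\<psi> \<circ> F \<circ> inv_into U \<phi>) x \<in> \<psi> ` (V \<inter> g -` W)" if "x \<in> S c" for x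
          using that inj by (auto simp: S_def V)
      qed
      then show ?thesis
        by (rule Ck_on_cong[OF opS[OF c], rotated]) (use inj injV in \<open>auto simp: S_def V\<close>)
    qed
    then show ?thesis
      unfolding cover using opS by (intro Ck_on_UN)
  qed
  moreover have "continuous_on UNIV (g \<circ> F)"
    unfolding comp_def by (rule continuous_on_compose2[OF contg contF]) simp
  ultimately show ?thesis
    by (intro smooth_mapI)
qed

lemma smooth_fun_compose:
  assumes "smooth_manifold A" "smooth_manifold B" "smooth_map A B F" "smooth_fun B g"
  shows "smooth_fun A (g \<circ> F)"
  using assms(4) unfolding smooth_fun_def
  by (rule smooth_map_compose[OF assms(1,2) _ assms(3), rotated]) simp

text \<open>In charts, the partial map of \<open>F\<close> at a fixed point is \<open>F\<close> precomposed with the inclusion of an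
  affine slice, whichever chart around the fixed point is chosen.\<close>

lemma smooth_map_slice_left:
  fixes A :: "('m::{t2_space,second_countable_topology}, 'e::real_inner) chart set"
    and B :: "('n::{t2_space,second_countable_topology}, 'f::real_inner) chart set"
  assumes A: "smooth_manifold A" and B: "smooth_manifold B" and C: "\<forall>(W, \<rho>)\<in>C. open W"
    and F: "smooth_map (prod_atlas A B) C F"
  shows "smooth_map A C (\<lambda>x. F (x, b))"
proof -
  have contF: "continuous_on UNIV F"
    using F by (simp add: smooth_map_def)
  have cont: "continuous_on UNIV (\<lambda>x. F (x, b))"
    by (intro continuous_on_compose2[OF contF] continuous_intros) auto
  obtain V \<psi> where V: "(V, \<psi>) \<in> B" "b \<in> V"
    using B unfolding smooth_manifold_def by (metis UNIV_I UN_E prod.collapse)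
  have injV: "inj_on \<psi> V"
    using chart_inj_on smooth_manifold_chart[OF B V(1)] .
  have "Ck_on n (\<phi> ` (U \<inter> (\<lambda>x. F (x, b)) -` W)) (\<rho> \<circ> (\<lambda>x. F (x, b)) \<circ> inv_into U \<phi>)"
    if U: "(U, \<phi>) \<in> A" and W: "(W, \<rho>) \<in> C" for U \<phi> W \<rho> n
  proof -
    have inj: "inj_on \<phi> U"
      using chart_inj_on smooth_manifold_chart[OF A U] .
    have injp: "inj_on (map_prod \<phi> \<psi>) (U \<times> V)"
      using inj injV by (rule map_prod_inj_on)
    have op: "open (\<phi> ` (U \<inter> (\<lambda>x. F (x, b)) -` W))"
      using C W cont by (auto intro!: open_chart_image[OF smooth_manifold_chart[OF A U]] open_vimage)
    have "(U \<times> V, map_prod \<phi> \<psi>) \<in> prod_atlas A B"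
      using U V(1) by (auto simp: prod_atlas_def)
    then have g: "Ck_on n (map_prod \<phi> \<psi> ` (U \<times> V \<inter> F -` W))
        (\<rho> \<circ> F \<circ> inv_into (U \<times> V) (map_prod \<phi> \<psi>))"
      by (rule smooth_map_Ck_on[OF F _ W])
    have inv: "inv_into (U \<times> V) (map_prod \<phi> \<psi>) (\<phi> x, \<psi> b) = (x, b)" if "x \<in> U" for x
      using inv_into_f_f[OF injp, of "(x, b)"] that V(2) by simp
    have "Ck_on n (\<phi> ` (U \<inter> (\<lambda>x. F (x, b)) -` W))
      (\<lambda>e. (\<rho> \<circ> F \<circ> inv_into (U \<times> V) (map_prod \<phi> \<psi>)) ((e, 0) + (0, \<psi> b)))"
    proof (rule Ck_on_compose_affine[OF _ op _ g])
      show "bounded_linear (\<lambda>e::'e. (e, 0::'f))"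
        by (intro bounded_linear_Pair bounded_linear_ident bounded_linear_zero)
    qed (use V(2) in \<open>force simp: image_iff\<close>)
    then show ?thesis
      by (rule Ck_on_cong[OF op, rotated]) (use inj inv in auto)
  qed
  with cont show ?thesis
    by (rule smooth_mapI)
qed

lemma smooth_map_slice_right:
  fixes A :: "('m::{t2_space,second_countable_topology}, 'e::real_inner) chart set"
    and B :: "('n::{t2_space,second_countable_topology}, 'f::real_inner) chart set"
  assumes A: "smooth_manifold A" and B: "smooth_manifold B" and C: "\<forall>(W, \<rho>)\<in>C. open W"
    and F: "smooth_map (prod_atlas A B) C F"
  shows "smooth_map B C (\<lambda>y. F (a, y))"
proof -
  have contF: "continuous_on UNIV F"
    using F by (simp add: smooth_map_def)
  have cont: "continuous_on UNIV (\<lambda>y. F (a, y))"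
    by (intro continuous_on_compose2[OF contF] continuous_intros) auto
  obtain U \<phi> where U: "(U, \<phi>) \<in> A" "a \<in> U"
    using A unfolding smooth_manifold_def by (metis UNIV_I UN_E prod.collapse)
  have injU: "inj_on \<phi> U"
    using chart_inj_on smooth_manifold_chart[OF A U(1)] .
  have "Ck_on n (\<psi> ` (V \<inter> (\<lambda>y. F (a, y)) -` W)) (\<rho> \<circ> (\<lambda>y. F (a, y)) \<circ> inv_into V \<psi>)"
    if V: "(V, \<psi>) \<in> B" and W: "(W, \<rho>) \<in> C" for V \<psi> W \<rho> n
  proof -
    have inj: "inj_on \<psi> V"
      using chart_inj_on smooth_manifold_chart[OF B V] .
    have injp: "inj_on (map_prod \<phi> \<psi>) (U \<times> V)"
      using injU inj by (rule map_prod_inj_on)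
    have op: "open (\<psi> ` (V \<inter> (\<lambda>y. F (a, y)) -` W))"
      using C W cont by (auto intro!: open_chart_image[OF smooth_manifold_chart[OF B V]] open_vimage)
    have "(U \<times> V, map_prod \<phi> \<psi>) \<in> prod_atlas A B"
      using V U(1) by (auto simp: prod_atlas_def)
    then have g: "Ck_on n (map_prod \<phi> \<psi> ` (U \<times> V \<inter> F -` W))
        (\<rho> \<circ> F \<circ> inv_into (U \<times> V) (map_prod \<phi> \<psi>))"
      by (rule smooth_map_Ck_on[OF F _ W])
    have inv: "inv_into (U \<times> V) (map_prod \<phi> \<psi>) (\<phi> a, \<psi> y) = (a, y)" if "y \<in> V" for y
      using inv_into_f_f[OF injp, of "(a, y)"] that U(2) by simp
    have "Ck_on n (\<psi> ` (V \<inter> (\<lambda>y. F (a, y)) -` W))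
      (\<lambda>e. (\<rho> \<circ> F \<circ> inv_into (U \<times> V) (map_prod \<phi> \<psi>)) ((0, e) + (\<phi> a, 0)))"
    proof (rule Ck_on_compose_affine[OF _ op _ g])
      show "bounded_linear (\<lambda>e::'f. (0::'e, e))"
        by (intro bounded_linear_Pair bounded_linear_ident bounded_linear_zero)
    qed (use U(2) in \<open>force simp: image_iff\<close>)
    then show ?thesis
      by (rule Ck_on_cong[OF op, rotated]) (use inj inv in auto)
  qed
  with cont show ?thesis
    by (rule smooth_mapI)
qed

section \<open>Derivations and their differentials\<close>

lemma smooth_fun_iff:
  "smooth_fun A g \<longleftrightarrow>
     continuous_on UNIV g \<and> (\<forall>(U, \<phi>)\<in>A. \<forall>n. Ck_on n (\<phi> ` U) (\<lambda>x. g (inv_into U \<phi> x)))"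
  by (auto simp: smooth_fun_def smooth_map_def smooth_on_def comp_def)

lemma smooth_manifold_open_image: "smooth_manifold A \<Longrightarrow> (U, \<phi>) \<in> A \<Longrightarrow> open (\<phi> ` U)"
  by (auto simp: smooth_manifold_def is_chart_def)

lemma smooth_fun_add:
  assumes "smooth_manifold A" "smooth_fun A f" "smooth_fun A g"
  shows "smooth_fun A (\<lambda>x. f x + g x)"
  using assms(2,3) smooth_manifold_open_image[OF assms(1)] unfolding smooth_fun_iff
  by (fastforce intro: continuous_on_add Ck_on_add)

lemma smooth_fun_mult:
  assumes "smooth_manifold A" "smooth_fun A f" "smooth_fun A g"
  shows "smooth_fun A (\<lambda>x. f x * g x)"
  using assms(2,3) smooth_manifold_open_image[OF assms(1)] unfolding smooth_fun_iff
  by (fastforce intro: continuous_on_mult Ck_on_bounded_bilinear[OF bounded_bilinear_mult])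

lemma smooth_fun_cmult:
  assumes "smooth_manifold A" "smooth_fun A f"
  shows "smooth_fun A (\<lambda>x. c * f x)"
proof (rule smooth_fun_mult[OF assms(1) _ assms(2)])
  show "smooth_fun A (\<lambda>x. c)"
    using smooth_manifold_open_image[OF assms(1)] unfolding smooth_fun_iff
    by (auto intro: Ck_on_const)
qed

lemma tangent_map_in_tangent_space:
  assumes "smooth_manifold A" "smooth_manifold B" "smooth_map A B F" "v \<in> tangent_space A p"
  shows "tangent_map B F v \<in> tangent_space B (F p)"
proof -
  have pull: "smooth_fun A (\<lambda>x. g (F x))" if "smooth_fun B g" for g
    using smooth_fun_compose[OF assms(1-3) that] by (simp add: comp_def)
  show ?thesis
    using assms(4)
    by (auto simp: tangent_space_def tangent_map_def comp_def pull
        smooth_fun_add[OF assms(2)] smooth_fun_mult[OF assms(2)] smooth_fun_cmult[OF assms(2)])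
qed

lemma tangent_space_diff:
  assumes "v \<in> tangent_space A p" "w \<in> tangent_space A p"
  shows "(\<lambda>g. v g - w g) \<in> tangent_space A p"
  using assms by (auto simp: tangent_space_def algebra_simps)

text \<open>Derivations that agree on smooth functions are equal because of their normalisation, so
  uniqueness of the velocity is uniqueness of one-dimensional derivatives.\<close>

lemma has_velocity_unique:
  assumes "has_velocity A c v T t" "has_velocity A d w T t" "\<And>s. s \<in> T \<Longrightarrow> c s = d s"
    and "t \<in> T" "at t within T \<noteq> bot"
  shows "v = w"
proof
  fix g show "v g = w g"
  proof (cases "smooth_fun A g")
    case True
    have "((\<lambda>s. g (c s)) has_real_derivative v g) (at t within T)"
      and d: "((\<lambda>s. g (d s)) has_real_derivative w g) (at t within T)"
      using assms(1,2) True by (auto simp: has_velocity_def)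
    then have "((\<lambda>s. g (d s)) has_real_derivative v g) (at t within T)"
      using assms(3,4) by (elim has_field_derivative_transform_within[where d=1]) auto
    then show ?thesis
      using has_field_derivative_unique d assms(5) by blast
  next
    case False
    then show ?thesis
      using assms(1,2) by (auto simp: has_velocity_def tangent_space_def)
  qed
qed

lemma has_velocity_subset:
  assumes "has_velocity A c v S t" "T \<subseteq> S"
  shows "has_velocity A c v T t"
  using assms unfolding has_velocity_def by (blast intro: has_field_derivative_subset)

section \<open>The projected vector field\<close>

text \<open>The action law rewrites \<open>h(XZ, y0)\<close> as \<open>h(Z, h(X, y0))\<close>, which depends on \<open>X\<close> only through
  the point of the orbit.\<close>

lemma projected_velocity_cong:
  assumes "right_lie_action G A B h" "h X y0 = h X' y0"
  shows "projected_velocity G A B h y0 X u = projected_velocity G A B h y0 X' u"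
proof -
  have "h (X \<otimes>\<^bsub>G\<^esub> Z) y0 = h (X' \<otimes>\<^bsub>G\<^esub> Z) y0" for Z
    using assms unfolding right_lie_action_def by metis
  then have "(\<lambda>Z. h Z y0) \<circ> (\<lambda>Z. X \<otimes>\<^bsub>G\<^esub> Z) = (\<lambda>Z. h Z y0) \<circ> (\<lambda>Z. X' \<otimes>\<^bsub>G\<^esub> Z)"
    by (simp add: fun_eq_iff)
  then show ?thesis
    by (simp add: projected_velocity_def left_translate_def tangent_map_def comp_assoc
        cong: if_cong)
qed

lemma projected_velocity_in_tangent_space:
  assumes G: "lie_group G A" and B: "smooth_manifold B" and h: "right_lie_action G A B h"
    and u: "u \<in> lie_algebra G A"
  shows "projected_velocity G A B h y0 X u \<in> tangent_space B (h X y0)"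
proof -
  have A: "smooth_manifold A" and "group G" "carrier G = UNIV"
    using G by (auto simp: lie_group_def)
  then have one: "X \<otimes>\<^bsub>G\<^esub> \<one>\<^bsub>G\<^esub> = X"
    by (simp add: group.is_monoid monoid.r_one)
  have open_charts: "\<forall>(W, \<rho>)\<in>A. open W" "\<forall>(W, \<rho>)\<in>B. open W"
    using A B by (auto simp: smooth_manifold_def is_chart_def)
  have "smooth_map A A (\<lambda>Z. X \<otimes>\<^bsub>G\<^esub> Z)"
    using smooth_map_slice_right[OF A A open_charts(1), of "\<lambda>(X, Y). X \<otimes>\<^bsub>G\<^esub> Y" X] G
    by (simp add: lie_group_def)
  then have "left_translate G A X u \<in> tangent_space A X"
    using tangent_map_in_tangent_space[OF A A, of "\<lambda>Z. X \<otimes>\<^bsub>G\<^esub> Z" u "\<one>\<^bsub>G\<^esub>"] u one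
    by (simp add: left_translate_def lie_algebra_def)
  moreover have "smooth_map A B (\<lambda>Z. h Z y0)"
    using smooth_map_slice_left[OF A B open_charts(2), of "\<lambda>(X, y). h X y" y0] h
    by (simp add: right_lie_action_def)
  ultimately show ?thesis
    unfolding projected_velocity_def by (rule tangent_map_in_tangent_space[OF A B, rotated])
qed

text \<open>Along a matched pair of trajectories the observer and the projected system are driven along
  one and the same curve, so their right-hand sides agree there.\<close>

lemma internal_model_rhs:
  assumes "has_internal_model G A B h y0 T f" "admissible_input G A u"
    and "projected_solution G A B h y0 u z y" "observer_solution B T f u y z yhat"
    and "t \<in> T" "at t within T \<noteq> bot" "h X y0 = yhat t"
  shows "f (yhat t) (u t) (y t) t = projected_velocity G A B h y0 X (u t)"
proof -
  have eq: "yhat s = y s" if "s \<in> T" for s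
    using assms(1-4) that unfolding has_internal_model_def by blast
  have "has_velocity B y (projected_velocity G A B h y0 X (u t)) T t"
    using assms(3,5,7) eq has_velocity_subset[OF _ subset_UNIV]
    unfolding projected_solution_def by metis
  moreover have "has_velocity B yhat (f (yhat t) (u t) (y t) t) T t"
    using assms(4,5) by (simp add: observer_solution_def)
  ultimately show ?thesis
    using has_velocity_unique eq assms(5,6) by metis
qed

section \<open>Observers with an internal model\<close>

theorem proposition15:
  fixes G :: "('g::{t2_space,second_countable_topology}) monoid"
    and A :: "('g, 'e::real_inner) chart set"
    and B :: "('m::{t2_space,second_countable_topology}, 'f::real_inner) chart set"
    and h :: "'g \<Rightarrow> 'm \<Rightarrow> 'm" and y0 :: 'm and f :: "('g, 'm) rhs"
  assumes "lie_group G A" and "connected (UNIV :: 'g set)"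
    and "smooth_manifold B" and "connected (UNIV :: 'm set)"
    and "right_lie_action G A B h" and "transitive_action h"
    and "closed (stabilizer h y0)"
    and "tangent_valued G A B f"
    and "has_internal_model G A B h y0 {0..} f"
  shows "\<exists>\<alpha>. innovation_term G A B h y0 {0..} f \<alpha> \<and>
    (has_internal_model G A B h y0 UNIV f \<longrightarrow> innovation_term G A B h y0 UNIV f \<alpha>) \<and>
    (\<forall>yhat y t X. \<forall>u\<in>lie_algebra G A. h X y0 = yhat \<longrightarrow>
       f yhat u y t = (\<lambda>g. projected_velocity G A B h y0 X u g + \<alpha> yhat u y t g))"
proof -
  \<comment> \<open>A group element over each point of the manifold; by \<open>projected_velocity_cong\<close> the choice does
    not matter.\<close>
  define s where "s p = (SOME X. h X y0 = p)" for p
  define \<alpha> where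
    "\<alpha> p u y t = (\<lambda>g. f p u y t g - projected_velocity G A B h y0 (s p) u g)" for p u y t
  have s: "h (s p) y0 = p" for p
    unfolding s_def
    by (rule someI_ex[where P="\<lambda>X. h X y0 = p"])
      (use assms(6) in \<open>simp add: transitive_action_def\<close>)
  have tangent: "tangent_valued G A B \<alpha>"
    unfolding tangent_valued_def \<alpha>_def
  proof (intro allI ballI tangent_space_diff)
    fix yhat y t u assume u: "u \<in> lie_algebra G A"
    show "f yhat u y t \<in> tangent_space B yhat"
      using assms(8) u by (simp add: tangent_valued_def)
    show "projected_velocity G A B h y0 (s yhat) u \<in> tangent_space B yhat"
      using projected_velocity_in_tangent_space[OF assms(1,3,5) u, of y0 "s yhat"] s by simp
  qed
  have innovation: "innovation_term G A B h y0 T f \<alpha>"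
    if "has_internal_model G A B h y0 T f" and "\<And>t. t \<in> T \<Longrightarrow> at t within T \<noteq> bot" for T
    unfolding innovation_term_def
  proof (intro conjI allI impI ballI)
    show "tangent_valued G A B \<alpha>" by (rule tangent)
    fix u z y yhat t
    assume "admissible_input G A u" "projected_solution G A B h y0 u z y"
      "observer_solution B T f u y z yhat" "t \<in> T"
    from internal_model_rhs[OF that(1) this that(2)[OF this(4)] s]
    show "\<alpha> (yhat t) (u t) (y t) t = (\<lambda>g. 0)"
      by (simp add: \<alpha>_def)
  qed
  have half_line: "at t within {0..} \<noteq> bot" if "t \<in> {0..}" for t :: real
  proof -
    have "at_right t \<le> at t within {0..}"
      using that by (intro at_le) auto
    then show ?thesis
      using trivial_limit_at_right_real[of t] by (metis bot.extremum_uniqueI)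
  qed
  have "f yhat u y t = (\<lambda>g. projected_velocity G A B h y0 X u g + \<alpha> yhat u y t g)"
    if "h X y0 = yhat" for yhat u y t X
    using projected_velocity_cong[OF assms(5), of X y0 "s yhat" u] that s by (simp add: \<alpha>_def)
  then show ?thesis
    using innovation[OF assms(9) half_line] innovation[of UNIV] by auto
qed

end
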